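(* Let $p,q,r$ be arbitrary integers, and define integers $x,y,n$ by \[ \begin{aligned} x &= 4r(16p^2r^2 + 8pr + 4r^2 + 1)q^2 - 8r(4p^2r^2 - 4p^2r + 2pr + r^2 - p - r)q - 2r(4p^2r - 2p^2 + 2p + r - 1),\\ y &= -2(4pr + 1)(16p^2r^2 + 8pr + 4r^2 + 1)q^2 + 4(4pr + 1)(4p^2r^2 - 4p^2r+ 2pr + r^2 - p - r)q\\ &\qquad + 16p^3r^2 - 8p^3r + 8p^2r + 4pr^2 - 2p^2 - 4pr - 1,\\ n &= x^2+y^2. \end{aligned} \] Then each of the three consecutive integers $n-1$, $n$, $n+1$ can be written as a sum of two squares of integers. *)

theory Defs
  imports Main
begin

definition sum_of_two_squares :: "int \<Rightarrow> bool" where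
  "sum_of_two_squares m \<longleftrightarrow> (\<exists>a b :: int. m = a\<^sup>2 + b\<^sup>2)"

end

theory Submission
  imports Defs
begin

theorem theorem3p1:
  fixes p q r x y n :: int
  assumes "x = 4*r*(16*p^2*r^2 + 8*p*r + 4*r^2 + 1)*q^2
             - 8*r*(4*p^2*r^2 - 4*p^2*r + 2*p*r + r^2 - p - r)*q
             - 2*r*(4*p^2*r - 2*p^2 + 2*p + r - 1)"
    and "y = - 2*(4*p*r + 1)*(16*p^2*r^2 + 8*p*r + 4*r^2 + 1)*q^2
             + 4*(4*p*r + 1)*(4*p^2*r^2 - 4*p^2*r + 2*p*r + r^2 - p - r)*q
             + 16*p^3*r^2 - 8*p^3*r + 8*p^2*r + 4*p*r^2 - 2*p^2 - 4*p*r - 1"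
    and "n = x^2 + y^2"
  shows "sum_of_two_squares (n - 1) \<and> sum_of_two_squares n \<and> sum_of_two_squares (n + 1)"
proof -
  \<comment> \<open>Put \<open>D = (2r)\<^sup>2 + (4pr+1)\<^sup>2\<close>. Completing squares in \<open>q\<close> shows that \<open>D (n - 1)\<close> and \<open>D (n + 1)\<close>
    are norms of Gaussian integers divisible by \<open>4pr+1 - 2ri\<close>; the quotients are the witnesses below.\<close>
  have "n - 1 = (x + 2*(4*p*r + 1)*q + 2*p)\<^sup>2 + (y + 4*r*q + 1)\<^sup>2"
    unfolding assms by algebra
  \<comment> \<open>Once \<open>x^2 + y^2\<close> cancels, both identities are linear in
    \<open>x\<close> and \<open>y\<close>. The shift here is \<open>(4*p*r + 1, 2*r)\<close>; the
    one for \<open>n - 1\<close> is \<open>2*q\<close> times it plus \<open>(2*p, 1)\<close>. Since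
    \<open>(4*p*r + 1)*1 - 2*r*(2*p) = 1\<close>, the two linear equations have determinant 1 up to
    scaling, and the given \<open>x\<close> and \<open>y\<close> are their only solution.\<close>
  moreover have "n + 1 = (x + 4*p*r + 1)\<^sup>2 + (y + 2*r)\<^sup>2"
    unfolding assms by algebra
  ultimately show ?thesis
    using assms(3) unfolding sum_of_two_squares_def by blast
qed

end
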